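(* For each natural number $n \geq 1$ there exists a constant $h_n > 0$, depending only on $n$, such that the following holds. Let $M^n$ be a closed, convex hypersurface in $\mathbb{R}^{n+1}$ with intrinsic distance $d_M$ and $n$-dimensional Hausdorff measure $\mathrm{Area}(M)$, let $\alpha : M \to M$ be a continuous map, and let $\mu(\alpha) = \min_{x \in M} d_M(x,\alpha(x))$. Then $$\mathrm{Area}(M) > h_n\, \mu(\alpha)^n.$$
   Context: A closed, convex hypersurface $M^n$ in $\mathbb{R}^{n+1}$ is the boundary of a compact convex set with nonempty interior in $\mathbb{R}^{n+1}$; no smoothness is assumed. The intrinsic distance $d_M(x,y)$ is the minimal length of a path contained in $M$ connecting $x$ and $y$. *)

theory Defs
  imports "HOL-Analysis.Analysis"
begin

definition closed_convex_hypersurface :: "'a::euclidean_space set \<Rightarrow> bool" where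
  "closed_convex_hypersurface M \<longleftrightarrow>
    (\<exists>K. compact K \<and> convex K \<and> interior K \<noteq> {} \<and> M = frontier K)"

text \<open>The length of a path on the unit interval: the supremum of the lengths of inscribed
  polygons. It is infinite for non-rectifiable paths.\<close>

definition path_length :: "(real \<Rightarrow> 'a::metric_space) \<Rightarrow> ennreal" where
  "path_length g =
    (SUP ts \<in> {ts. sorted ts \<and> set ts \<subseteq> {0..1}}.
       ennreal (\<Sum>i<length ts - 1. dist (g (ts ! i)) (g (ts ! Suc i))))"

text \<open>The minimal length is written as an infimum, so that the value does not presuppose that a
  shortest path exists; it is infinite if no rectifiable path in \<open>M\<close> joins \<open>x\<close> to \<open>y\<close>.\<close>

definition intrinsic_dist :: "'a::metric_space set \<Rightarrow> 'a \<Rightarrow> 'a \<Rightarrow> ennreal" where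
  "intrinsic_dist M x y =
    (INF g \<in> {g. path g \<and> path_image g \<subseteq> M \<and> pathstart g = x \<and> pathfinish g = y}. path_length g)"

text \<open>\<open>\<mu>(\<alpha>)\<close>, again with an infimum in place of the minimum.\<close>

definition min_displacement :: "'a::metric_space set \<Rightarrow> ('a \<Rightarrow> 'a) \<Rightarrow> ennreal" where
  "min_displacement M \<alpha> = (INF x\<in>M. intrinsic_dist M x (\<alpha> x))"

text \<open>The Hausdorff (outer) measure of dimension \<open>d\<close>, normalised to agree with Lebesgue measure
  on \<open>d\<close>-dimensional Euclidean space. The sets of a cover must be required to be bounded, since
  the library function \<^const>\<open>diameter\<close> is unspecified on unbounded sets. The empty set is given
  weight \<open>0\<close> separately because \<open>0 ^ 0 = 1\<close>; this matters only for \<open>d = 0\<close>.\<close>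

definition hausdorff_weight :: "nat \<Rightarrow> 'a::metric_space set \<Rightarrow> ennreal" where
  "hausdorff_weight d U =
    (if U = {} then 0 else ennreal (unit_ball_vol (real d) * (diameter U / 2) ^ d))"

definition hausdorff_premeasure :: "nat \<Rightarrow> real \<Rightarrow> 'a::metric_space set \<Rightarrow> ennreal" where
  "hausdorff_premeasure d \<delta> S =
    (INF U \<in> {U :: nat \<Rightarrow> 'a set. S \<subseteq> (\<Union>i. U i) \<and> (\<forall>i. bounded (U i) \<and> diameter (U i) \<le> \<delta>)}.
       (\<Sum>i. hausdorff_weight d (U i)))"

definition hausdorff_measure :: "nat \<Rightarrow> 'a::metric_space set \<Rightarrow> ennreal" where
  "hausdorff_measure d S = (SUP \<delta>\<in>{0<..}. hausdorff_premeasure d \<delta> S)"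

end

theory Submission
  imports Defs
begin

text \<open>Let \<open>K\<close> be the convex body with boundary \<open>M\<close>, and call the set of lines of direction \<open>e\<close>
  that meet \<open>M\<close> its shadow along \<open>e\<close>. The area of \<open>M\<close> is at least a constant times the
  \<open>n\<close>-dimensional size of any of its shadows, so it is enough to find, whenever
  \<open>0 < r \<le> \<mu>(\<alpha>)\<close>, a direction \<open>e\<close> along which the shadow contains an \<open>n\<close>-dimensional disc of
  radius proportional to \<open>r\<close> (\<open>shadow_disc_of_displacement\<close>).

  If every width of \<open>K\<close> is at least \<open>w = r / 32\<close>, then \<open>K\<close> contains a ball of radius
  \<open>w / (n + 2)\<close> (\<open>ball_in_thick_body\<close>) and any \<open>e\<close> will do. Otherwise let \<open>e\<close> be a direction in
  which \<open>K\<close> is thinner than \<open>w\<close>. Projecting along \<open>e\<close> and applying Brouwer's theorem to the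
  projection of \<open>K\<close> gives a point \<open>x\<close> of \<open>M\<close> such that \<open>x\<close> and \<open>\<alpha>(x)\<close> lie on one line of
  direction \<open>e\<close> (\<open>fixed_fibre_exists\<close>). They are close in space but have intrinsic distance at
  least \<open>r\<close>, so there is no short way around \<open>K\<close> from one to the other. For every \<open>v\<close>
  orthogonal to \<open>e\<close> with \<open>|v| \<le> w\<close>, the line through \<open>x + v\<close> of direction \<open>e\<close> must therefore
  meet \<open>K\<close>: otherwise a path could leave \<open>K\<close> at \<open>x\<close>, move by \<open>v\<close> on one side of \<open>K\<close>, pass
  along this line to the other side, and return to \<open>\<alpha>(x)\<close>, all within length less than \<open>r\<close>
  (\<open>intrinsic_dist_le_detour\<close>). So the shadow contains the disc of radius \<open>w\<close> about \<open>x\<close>.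

  The area bound (\<open>hausdorff_measure_ge_shadow\<close>) is a volume count in the ambient space: a ball
  over the disc in the shadow is covered by the cylinders of direction \<open>e\<close> over the sets of any
  cover of \<open>M\<close>, and the cylinder over a set of diameter \<open>D\<close> is covered by a stack of balls of
  radius \<open>2D\<close>.

  The strict inequality needs two more remarks. A bounded set has no arbitrarily large disc in
  its shadow, so \<open>\<mu>(\<alpha>)\<close> is finite; and a convex body contains a ball, so its boundary has
  positive area, which is what is claimed when \<open>\<mu>(\<alpha>) = 0\<close>.\<close>

section \<open>Short detours around a convex body\<close>

lemma path_length_le_lipschitz:
  fixes g :: "real \<Rightarrow> 'a::metric_space"
  assumes "L-lipschitz_on {0..1} g"
  shows "path_length g \<le> ennreal L"
  unfolding path_length_def
proof (rule SUP_least)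
  fix ts :: "real list" assume "ts \<in> {ts. sorted ts \<and> set ts \<subseteq> {0..1}}"
  then have ts: "sorted ts" "set ts \<subseteq> {0..1}" by auto
  have L: "L \<ge> 0" using assms lipschitz_on_nonneg by blast
  have bound: "(\<Sum>i<m. dist (g (ts ! i)) (g (ts ! Suc i))) \<le> L * (ts ! m - ts ! 0)"
    if "m < length ts" for m
    using that
  proof (induction m)
    case 0
    then show ?case by simp
  next
    case (Suc m)
    have "ts ! m \<in> set ts" "ts ! Suc m \<in> set ts" using Suc.prems by auto
    then have "dist (g (ts ! m)) (g (ts ! Suc m)) \<le> L * dist (ts ! m) (ts ! Suc m)"
      using ts(2) by (intro lipschitz_onD[OF assms]) auto
    moreover have "dist (ts ! m) (ts ! Suc m) = ts ! Suc m - ts ! m"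
      using sorted_nth_mono[OF ts(1), of m "Suc m"] Suc.prems by (simp add: dist_real_def)
    ultimately show ?case using Suc by (simp add: algebra_simps)
  qed
  have "(\<Sum>i<length ts - 1. dist (g (ts ! i)) (g (ts ! Suc i))) \<le> L"
  proof (cases "ts = []")
    case True
    then show ?thesis using L by simp
  next
    case False
    let ?m = "length ts - 1"
    have "ts ! ?m \<in> set ts" "ts ! 0 \<in> set ts" using False by auto
    then have "ts ! ?m \<le> 1" "ts ! 0 \<ge> 0" using ts(2) by (auto simp: subset_eq)
    then have "L * (ts ! ?m - ts ! 0) \<le> L * 1" using L by (intro mult_left_mono) auto
    then show ?thesis using bound[of ?m] False by auto
  qed
  then show "ennreal (\<Sum>i<length ts - 1. dist (g (ts ! i)) (g (ts ! Suc i))) \<le> ennreal L"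
    by (rule ennreal_leI)
qed

text \<open>Lipschitz constants take the place of lengths: they pass through contractions and through
  concatenation (up to a factor \<open>2\<close>), and constants are of no concern here.\<close>
definition lipschitz_joined :: "'a::metric_space set \<Rightarrow> real \<Rightarrow> 'a \<Rightarrow> 'a \<Rightarrow> bool" where
  "lipschitz_joined S L x y \<longleftrightarrow>
    (\<exists>g. L-lipschitz_on {0..1} g \<and> g ` {0..1} \<subseteq> S \<and> g 0 = x \<and> g (1::real) = y)"

lemma lipschitz_joined_segment:
  fixes x y :: "'a::real_normed_vector"
  assumes "closed_segment x y \<subseteq> S" "dist x y \<le> L"
  shows "lipschitz_joined S L x y"
proof -
  have "L-lipschitz_on {0..1} (linepath x y)"
  proof (rule lipschitz_onI)
    show "0 \<le> L" using assms(2) zero_le_dist order_trans by blast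
    fix s t :: real
    have "linepath x y s - linepath x y t = (t - s) *\<^sub>R (x - y)"
      by (simp add: linepath_def algebra_simps)
    then have "dist (linepath x y s) (linepath x y t) = dist s t * dist x y"
      by (simp add: dist_norm abs_minus_commute)
    also have "\<dots> \<le> L * dist s t"
      using assms(2) by (subst mult.commute) (intro mult_right_mono, auto)
    finally show "dist (linepath x y s) (linepath x y t) \<le> L * dist s t" .
  qed
  moreover have "linepath x y ` {0..1} \<subseteq> S"
    using assms(1) path_image_linepath[of x y] by (simp add: path_image_def)
  ultimately show ?thesis
    unfolding lipschitz_joined_def by (intro exI[of _ "linepath x y"]) (auto simp: linepath_def)
qed

lemma lipschitz_joined_trans:
  assumes "lipschitz_joined S L x y" "lipschitz_joined S L y z"
  shows "lipschitz_joined S (2 * L) x z"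
proof -
  obtain g where g: "L-lipschitz_on {0..1} g" "g ` {0..1} \<subseteq> S" "g 0 = x" "g (1::real) = y"
    using assms(1) unfolding lipschitz_joined_def by blast
  obtain h where h: "L-lipschitz_on {0..1} h" "h ` {0..1} \<subseteq> S" "h 0 = y" "h (1::real) = z"
    using assms(2) unfolding lipschitz_joined_def by blast
  let ?k = "\<lambda>t::real. if t \<le> 1/2 then g (2 * t) else h (2 * t - 1)"
  have L: "L \<ge> 0" using g(1) lipschitz_on_nonneg by blast
  have dist2: "dist (2 * s) (2 * t) = 2 * dist s t" for s t :: real
    using abs_mult[of 2 "s - t"] by (simp add: dist_real_def)
  have dist2': "dist (2 * s - 1) (2 * t - 1) = 2 * dist s t" for s t :: real
    using abs_mult[of 2 "s - t"] by (simp add: dist_real_def)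
  have "(2 * L)-lipschitz_on {0..1/2} (\<lambda>t. g (2 * t))"
  proof (rule lipschitz_onI)
    fix s t :: real assume "s \<in> {0..1/2}" "t \<in> {0..1/2}"
    then have "dist (g (2 * s)) (g (2 * t)) \<le> L * dist (2 * s) (2 * t)"
      by (intro lipschitz_onD[OF g(1)]) auto
    then show "dist (g (2 * s)) (g (2 * t)) \<le> 2 * L * dist s t"
      using dist2[of s t] by simp
  qed (use L in simp)
  moreover have "(2 * L)-lipschitz_on {1/2..1} (\<lambda>t. h (2 * t - 1))"
  proof (rule lipschitz_onI)
    fix s t :: real assume "s \<in> {1/2..1}" "t \<in> {1/2..1}"
    then have "dist (h (2 * s - 1)) (h (2 * t - 1)) \<le> L * dist (2 * s - 1) (2 * t - 1)"
      by (intro lipschitz_onD[OF h(1)]) auto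
    then show "dist (h (2 * s - 1)) (h (2 * t - 1)) \<le> 2 * L * dist s t"
      using dist2'[of s t] by simp
  qed (use L in simp)
  ultimately have "(2 * L)-lipschitz_on {0..1} ?k"
    by (rule lipschitz_on_concat) (simp add: g(4) h(3))
  moreover have "?k t \<in> S" if "t \<in> {0..1}" for t
    using subsetD[OF g(2), of "g (2 * t)"] subsetD[OF h(2), of "h (2 * t - 1)"] that by auto
  moreover have "?k 0 = x" "?k 1 = z" using g(3) h(4) by auto
  ultimately show ?thesis
    unfolding lipschitz_joined_def by (intro exI[of _ ?k] conjI image_subsetI) simp_all
qed

text \<open>A path outside the body is retracted onto the boundary by the nearest-point projection,
  which is a contraction. This replaces every explicit construction of curves in a convex
  hypersurface.\<close>
lemma intrinsic_dist_le_outer_path: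
  fixes K :: "'a::euclidean_space set"
  assumes K: "compact K" "convex K" "interior K \<noteq> {}"
    and xy: "x \<in> frontier K" "y \<in> frontier K"
    and joined: "lipschitz_joined (- interior K) L x y"
  shows "intrinsic_dist (frontier K) x y \<le> ennreal L"
proof -
  have cl: "closed K" "K \<noteq> {}" using K compact_imp_closed interior_subset by auto
  obtain g where g: "L-lipschitz_on {0..1} g" "g ` {0..1} \<subseteq> - interior K" "g 0 = x" "g (1::real) = y"
    using joined unfolding lipschitz_joined_def by blast
  define p where "p = closest_point K \<circ> g"
  have lip: "L-lipschitz_on {0..1} p"
  proof (rule lipschitz_onI)
    fix s t :: real assume st: "s \<in> {0..1}" "t \<in> {0..1}"
    have "dist (p s) (p t) \<le> dist (g s) (g t)"
      unfolding p_def o_def using K cl by (intro closest_point_lipschitz) auto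
    also have "\<dots> \<le> L * dist s t" using lipschitz_onD[OF g(1) st] .
    finally show "dist (p s) (p t) \<le> L * dist s t" .
  qed (use g(1) lipschitz_on_nonneg in blast)
  have aff: "affine hull K = UNIV" using K(3) affine_hull_nonempty_interior by blast
  have ri: "rel_interior K = interior K" using K(3) rel_interior_nonempty_interior by blast
  \<comment> \<open>Nearest points of points outside the interior are not interior.\<close>
  have "p t \<in> frontier K" if "t \<in> {0..1}" for t
  proof -
    have "g t \<notin> interior K" using subsetD[OF g(2) imageI[OF that]] by simp
    then have "p t \<notin> interior K"
      using closest_point_in_rel_interior[OF cl, of "g t"] K(2) aff ri by (simp add: p_def)
    moreover have "p t \<in> K" using closest_point_in_set[OF cl] by (simp add: p_def)
    ultimately show ?thesis using cl by (simp add: frontier_def)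
  qed
  then have "path_image p \<subseteq> frontier K" by (auto simp: path_image_def)
  moreover have "path p" unfolding path_def using lip lipschitz_on_continuous_on by blast
  moreover have "pathstart p = x" "pathfinish p = y"
    using g(3,4) xy cl closest_point_self[of _ K]
    by (auto simp: p_def pathstart_def pathfinish_def frontier_def)
  ultimately have "intrinsic_dist (frontier K) x y \<le> path_length p"
    unfolding intrinsic_dist_def by (intro INF_lower) auto
  then show ?thesis using path_length_le_lipschitz[OF lip] by (rule order_trans)
qed

text \<open>The path has five segments: from \<open>x\<close> against \<open>e\<close> until it is below the slab containing
  \<open>K\<close>, sideways by \<open>v\<close>, upwards along a line that misses \<open>K\<close>, back by \<open>-v\<close> above the slab, and
  down to \<open>x + b e\<close>. Each segment is at most \<open>3 w\<close> long, and joining five of them pairwise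
  multiplies the Lipschitz constant by \<open>8\<close>.\<close>
lemma intrinsic_dist_le_detour:
  fixes K :: "'a::euclidean_space set"
  assumes K: "compact K" "convex K" "interior K \<noteq> {}"
    and e: "norm e = 1"
    and thin: "\<And>k l. k \<in> K \<Longrightarrow> l \<in> K \<Longrightarrow> (k - l) \<bullet> e < w"
    and x: "x \<in> frontier K" and y: "x + b *\<^sub>R e \<in> frontier K" and b: "b > 0"
    and v: "v \<bullet> e = 0" "norm v \<le> w" and miss: "\<And>s. x + v + s *\<^sub>R e \<notin> K"
  shows "intrinsic_dist (frontier K) x (x + b *\<^sub>R e) \<le> ennreal (24 * w)"
proof -
  have fr: "frontier K = K - interior K"
    using K(1) by (simp add: frontier_def compact_imp_closed)
  have ee: "e \<bullet> e = 1" using e by (simp add: dot_square_norm)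
  have xK: "x \<in> K" and yK: "x + b *\<^sub>R e \<in> K" using x y fr by auto
  have bw: "b < w" using thin[OF yK xK] ee by simp
  have out: "z \<in> - interior K" if "\<bar>(z - x) \<bullet> e\<bar> \<ge> w" for z
  proof -
    have "z \<notin> K"
      using thin[of z x] thin[of x z] xK that by (auto simp: inner_diff_left)
    then show ?thesis using interior_subset by auto
  qed
  \<comment> \<open>An interior point below \<open>x\<close> would, together with \<open>x + b e\<close> above \<open>x\<close>, make the boundary
      point \<open>x\<close> interior. The next claim is the same argument upside down.\<close>
  have below: "x - t *\<^sub>R e \<in> - interior K" if "t \<ge> 0" for t
  proof
    assume i: "x - t *\<^sub>R e \<in> interior K"
    have "x \<in> interior K"
    proof (cases "t = 0")
      case True
      then show ?thesis using i by simp
    next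
      case False
      then have t: "t > 0" using that by simp
      have "x + b *\<^sub>R e - (b / (b + t)) *\<^sub>R (x + b *\<^sub>R e - (x - t *\<^sub>R e)) \<in> interior K"
        using t b by (intro mem_interior_convex_shrink K i yK) auto
      moreover have "x + b *\<^sub>R e - (b / (b + t)) *\<^sub>R (x + b *\<^sub>R e - (x - t *\<^sub>R e)) = x"
        using t b by (simp add: scaleR_left_distrib[symmetric])
      ultimately show ?thesis by (simp only:)
    qed
    then show False using x fr by simp
  qed
  have above: "x + b *\<^sub>R e + t *\<^sub>R e \<in> - interior K" if "t \<ge> 0" for t
  proof
    assume i: "x + b *\<^sub>R e + t *\<^sub>R e \<in> interior K"
    have "x + b *\<^sub>R e \<in> interior K"
    proof (cases "t = 0")
      case True
      then show ?thesis using i by simp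
    next
      case False
      then have t: "t > 0" using that by simp
      have "x - (b / (b + t)) *\<^sub>R (x - (x + b *\<^sub>R e + t *\<^sub>R e)) \<in> interior K"
        using t b by (intro mem_interior_convex_shrink K i xK) auto
      moreover have "x - (b / (b + t)) *\<^sub>R (x - (x + b *\<^sub>R e + t *\<^sub>R e)) = x + b *\<^sub>R e"
        using t b by (simp add: scaleR_left_distrib[symmetric] add.assoc)
      ultimately show ?thesis by (simp only:)
    qed
    then show False using y fr by simp
  qed
  let ?p1 = "x - w *\<^sub>R e" and ?p2 = "x - w *\<^sub>R e + v" and ?y = "x + b *\<^sub>R e"
  let ?p3 = "?y + w *\<^sub>R e + v" and ?p4 = "?y + w *\<^sub>R e"
  let ?J = "lipschitz_joined (- interior K)"
  have wpos: "w > 0" using b bw by simp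
  have 1: "?J (3 * w) x ?p1"
  proof (rule lipschitz_joined_segment)
    show "closed_segment x ?p1 \<subseteq> - interior K"
    proof
      fix z assume "z \<in> closed_segment x ?p1"
      then obtain u where u: "0 \<le> u" "z = (1 - u) *\<^sub>R x + u *\<^sub>R ?p1"
        unfolding closed_segment_def by blast
      have "z = x - (u * w) *\<^sub>R e" unfolding u by (simp add: algebra_simps)
      then show "z \<in> - interior K" using below[of "u * w"] u(1) wpos by simp
    qed
    show "dist x ?p1 \<le> 3 * w" using e wpos by (simp add: dist_norm)
  qed
  have 2: "?J (3 * w) ?p1 ?p2"
  proof (rule lipschitz_joined_segment)
    show "closed_segment ?p1 ?p2 \<subseteq> - interior K"
    proof
      fix z assume "z \<in> closed_segment ?p1 ?p2"
      then obtain u where u: "z = (1 - u) *\<^sub>R ?p1 + u *\<^sub>R ?p2"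
        unfolding closed_segment_def by blast
      have "z - x = u *\<^sub>R v - w *\<^sub>R e" unfolding u by (simp add: algebra_simps)
      then show "z \<in> - interior K" using v ee wpos by (intro out) (simp add: inner_diff_left)
    qed
    show "dist ?p1 ?p2 \<le> 3 * w" using v wpos by (simp add: dist_norm)
  qed
  have 3: "?J (3 * w) ?p2 ?p3"
  proof (rule lipschitz_joined_segment)
    show "closed_segment ?p2 ?p3 \<subseteq> - interior K"
    proof
      fix z assume "z \<in> closed_segment ?p2 ?p3"
      then obtain u where u: "z = (1 - u) *\<^sub>R ?p2 + u *\<^sub>R ?p3"
        unfolding closed_segment_def by blast
      have "z = x + v + (u * (b + 2 * w) - w) *\<^sub>R e" unfolding u by (simp add: algebra_simps)
        (simp flip: scaleR_left_distrib)
      then show "z \<in> - interior K" using miss interior_subset by auto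
    qed
    have "?p2 - ?p3 = - (b + 2 * w) *\<^sub>R e" by (simp add: algebra_simps)
      (simp flip: scaleR_left_distrib)
    then have "dist ?p2 ?p3 = b + 2 * w" using e wpos b by (simp add: dist_norm)
    then show "dist ?p2 ?p3 \<le> 3 * w" using bw by simp
  qed
  have 4: "?J (3 * w) ?p3 ?p4"
  proof (rule lipschitz_joined_segment)
    show "closed_segment ?p3 ?p4 \<subseteq> - interior K"
    proof
      fix z assume "z \<in> closed_segment ?p3 ?p4"
      then obtain u where u: "z = (1 - u) *\<^sub>R ?p3 + u *\<^sub>R ?p4"
        unfolding closed_segment_def by blast
      have "z - x = (1 - u) *\<^sub>R v + (b + w) *\<^sub>R e" unfolding u by (simp add: algebra_simps)
      then show "z \<in> - interior K" using v ee wpos b by (intro out) (simp add: inner_add_left)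
    qed
    show "dist ?p3 ?p4 \<le> 3 * w" using v wpos by (simp add: dist_norm)
  qed
  have 5: "?J (3 * w) ?p4 ?y"
  proof (rule lipschitz_joined_segment)
    show "closed_segment ?p4 ?y \<subseteq> - interior K"
    proof
      fix z assume "z \<in> closed_segment ?p4 ?y"
      then obtain u where u: "u \<le> 1" "z = (1 - u) *\<^sub>R ?p4 + u *\<^sub>R ?y"
        unfolding closed_segment_def by blast
      have "z = x + b *\<^sub>R e + ((1 - u) * w) *\<^sub>R e" unfolding u by (simp add: algebra_simps)
      then show "z \<in> - interior K" using above[of "(1 - u) * w"] u(1) wpos by simp
    qed
    show "dist ?p4 ?y \<le> 3 * w" using e wpos by (simp add: dist_norm)
  qed
  have weaken: "?J L' p q" if "?J L p q" "L \<le> L'" for L L' p q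
    using that lipschitz_on_le unfolding lipschitz_joined_def by blast
  have "?J (12 * w) x ?p3"
    using lipschitz_joined_trans[OF lipschitz_joined_trans[OF 1 2] weaken[OF 3]] wpos by simp
  moreover have "?J (12 * w) ?p3 ?y"
    using weaken[OF lipschitz_joined_trans[OF 4 5]] wpos by simp
  ultimately have "?J (24 * w) x ?y" using lipschitz_joined_trans by fastforce
  then show ?thesis by (rule intrinsic_dist_le_outer_path[OF K x y])
qed

section \<open>A boundary point moved along a prescribed direction\<close>

lemma norm_orthogonal_part_le:
  fixes z e :: "'a::real_inner"
  assumes "norm e = 1"
  shows "norm (z - (z \<bullet> e) *\<^sub>R e) \<le> norm z"
proof (rule power2_le_imp_le)
  have "e \<bullet> e = 1" using assms by (simp add: dot_square_norm)
  then have "(norm (z - (z \<bullet> e) *\<^sub>R e))\<^sup>2 = (norm z)\<^sup>2 - (z \<bullet> e)\<^sup>2"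
    unfolding power2_norm_eq_inner
    by (simp add: inner_diff_left inner_diff_right inner_commute power2_eq_square)
  then show "(norm (z - (z \<bullet> e) *\<^sub>R e))\<^sup>2 \<le> (norm z)\<^sup>2" by simp
qed simp

text \<open>If the lower boundary of \<open>K\<close> were the graph of a continuous function on the projection
  \<open>P = \<pi>(K)\<close>, with section \<open>\<phi>\<close>, Brouwer's theorem for \<open>\<pi> \<circ> \<alpha> \<circ> \<phi>\<close> on \<open>P\<close> would give the claim.
  The section need not be continuous at the boundary of \<open>P\<close>, so it is replaced by an approximate
  one: squeeze \<open>K\<close> in direction \<open>e\<close> by a small factor \<open>\<eta>\<close> and take the point nearest to a
  point just below it. In the squeezed picture vertical distances are \<open>O(\<eta>)\<close>, so the nearest
  point deviates horizontally by \<open>O(\<eta>)\<close> only. Compactness then removes the error.\<close>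
lemma fixed_fibre_exists:
  fixes K :: "'a::euclidean_space set"
  assumes K: "compact K" "convex K" "interior K \<noteq> {}"
    and \<alpha>: "continuous_on (frontier K) \<alpha>" "\<alpha> \<in> frontier K \<rightarrow> frontier K"
    and e: "norm e = 1"
  obtains x b where "x \<in> frontier K" "\<alpha> x = x + b *\<^sub>R e"
proof -
  define \<pi> where "\<pi> z = z - (z \<bullet> e) *\<^sub>R e" for z
  have ee: "e \<bullet> e = 1" using e by (simp add: dot_square_norm)
  have lin: "linear \<pi>"
    by (rule linearI) (simp_all add: \<pi>_def inner_add_left algebra_simps)
  have \<pi>_le: "norm (\<pi> z) \<le> norm z" for z
    unfolding \<pi>_def by (rule norm_orthogonal_part_le[OF e])
  have cont\<pi>: "continuous_on S \<pi>" for S unfolding \<pi>_def by (intro continuous_intros)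
  have fr: "frontier K = K - interior K" using K(1) by (simp add: frontier_def compact_imp_closed)
  have neK: "K \<noteq> {}" using K(3) interior_subset by blast
  obtain R where R: "R > 0" "\<And>z. z \<in> K \<Longrightarrow> norm z \<le> R"
    using compact_imp_bounded[OF K(1)] unfolding bounded_pos by blast
  have Re: "\<bar>z \<bullet> e\<bar> \<le> R" if "z \<in> K" for z
    using Cauchy_Schwarz_ineq2[of z e] R(2)[OF that] e by simp
  let ?P = "\<pi> ` K"
  have P: "compact ?P" "convex ?P" "?P \<noteq> {}"
    using K(1,2) neK cont\<pi> lin by (auto intro: compact_continuous_image convex_linear_image)
  have approx: "\<exists>x\<in>frontier K. norm (\<pi> (\<alpha> x) - \<pi> x) < \<epsilon>" if "\<epsilon> > 0" for \<epsilon>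
  proof -
    \<comment> \<open>The horizontal error is at most \<open>2 R \<eta>\<close>, which is to be less than \<open>\<epsilon>\<close>.
        \<open>A\<close> squeezes in direction \<open>e\<close> by \<open>\<eta>\<close>, and \<open>B\<close> undoes it.\<close>
    define \<eta> where "\<eta> = \<epsilon> / (4 * R)"
    have \<eta>: "\<eta> > 0" using that R(1) by (simp add: \<eta>_def)
    define A where "A z = z + ((\<eta> - 1) * (z \<bullet> e)) *\<^sub>R e" for z
    define B where "B z = z + ((1 / \<eta> - 1) * (z \<bullet> e)) *\<^sub>R e" for z
    have linA: "linear A"
      by (rule linearI) (simp_all add: A_def inner_add_left algebra_simps)
    have BA: "B (A z) = z" for z
    proof -
      have "A z \<bullet> e = \<eta> * (z \<bullet> e)" using ee by (simp add: A_def inner_add_left algebra_simps)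
      then have "B (A z) = z + ((\<eta> - 1) * (z \<bullet> e) + (1 / \<eta> - 1) * (\<eta> * (z \<bullet> e))) *\<^sub>R e"
        by (simp add: B_def A_def scaleR_left_distrib)
      also have "(\<eta> - 1) * (z \<bullet> e) + (1 / \<eta> - 1) * (\<eta> * (z \<bullet> e)) = 0"
        using \<eta> by (simp add: algebra_simps)
      finally show ?thesis by simp
    qed
    have injA: "inj A" using BA by (metis injI)
    have contA: "continuous_on S A" and contB: "continuous_on S B" for S
      unfolding A_def B_def by (intro continuous_intros)+
    have AK: "compact (A ` K)" "convex (A ` K)" "A ` K \<noteq> {}"
      using K(1,2) neK contA linA by (auto intro: compact_continuous_image convex_linear_image)
    have AK_closed: "closed (A ` K)" using AK(1) compact_imp_closed by blast
    have intA: "interior (A ` K) = A ` interior K"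
      using interior_injective_linear_image[OF linA injA] .
    have affA: "affine hull (A ` K) = UNIV" "rel_interior (A ` K) = interior (A ` K)"
      using K(3) intA affine_hull_nonempty_interior rel_interior_nonempty_interior by blast+
    define \<psi> where "\<psi> p = closest_point (A ` K) (A (p - R *\<^sub>R e))" for p
    define \<phi> where "\<phi> p = B (\<psi> p)" for p
    have \<phi>: "\<phi> p \<in> frontier K \<and> norm (\<pi> (\<phi> p) - p) < \<epsilon>" if p: "p \<in> ?P" for p
    proof -
      obtain k where k: "k \<in> K" "p = \<pi> k" using p by blast
      have pe: "p \<bullet> e = 0" using k ee by (simp add: \<pi>_def inner_diff_left)
      have "p - R *\<^sub>R e \<notin> interior K"
      proof
        assume "p - R *\<^sub>R e \<in> interior K"
        then obtain d where d: "d > 0" "cball (p - R *\<^sub>R e) d \<subseteq> K"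
          unfolding mem_interior_cball by blast
        have "p - R *\<^sub>R e - d *\<^sub>R e \<in> cball (p - R *\<^sub>R e) d"
          using d e by (simp add: dist_norm)
        then have "p - R *\<^sub>R e - d *\<^sub>R e \<in> K" using d by blast
        \<comment> \<open>This point is lower than \<open>-R\<close>, hence outside \<open>K\<close>.\<close>
        from Re[OF this] show False using pe ee d(1) R(1) by (simp add: inner_diff_left)
      qed
      then have "A (p - R *\<^sub>R e) \<notin> interior (A ` K)"
        unfolding intA using injA by (auto dest: injD)
      then have "\<psi> p \<notin> interior (A ` K)"
        using closest_point_in_rel_interior[OF AK_closed AK(3), of "A (p - R *\<^sub>R e)"] affA
        by (simp add: \<psi>_def)
      moreover have "\<psi> p \<in> A ` K"
        using closest_point_in_set[OF AK_closed AK(3)] by (simp add: \<psi>_def)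
      ultimately obtain x where x: "x \<in> frontier K" "\<psi> p = A x"
        unfolding intA fr by blast
      have \<phi>x: "\<phi> p = x" using x BA by (simp add: \<phi>_def)
      have "\<pi> (A x - A (p - R *\<^sub>R e)) = \<pi> x - p"
        using pe ee by (simp add: A_def \<pi>_def inner_diff_left inner_add_left algebra_simps)
      then have "norm (\<pi> x - p) \<le> dist (A (p - R *\<^sub>R e)) (\<psi> p)"
        using \<pi>_le[of "A x - A (p - R *\<^sub>R e)"] x(2) by (simp add: dist_norm norm_minus_commute)
      also have "\<dots> \<le> dist (A (p - R *\<^sub>R e)) (A k)"
        unfolding \<psi>_def using AK_closed k by (intro closest_point_le) auto
      also have "A (p - R *\<^sub>R e) = p - (\<eta> * R) *\<^sub>R e"
        using pe ee by (simp add: A_def inner_diff_left algebra_simps)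
      also have "A k = p + (\<eta> * (k \<bullet> e)) *\<^sub>R e"
        by (simp add: A_def k(2) \<pi>_def algebra_simps)
      also have "dist (p - (\<eta> * R) *\<^sub>R e) (p + (\<eta> * (k \<bullet> e)) *\<^sub>R e)
          = norm (- (\<eta> * (R + k \<bullet> e)) *\<^sub>R e)"
        by (simp add: dist_norm algebra_simps)
      also have "\<dots> = \<eta> * \<bar>R + k \<bullet> e\<bar>"
        using \<eta> e by (simp add: abs_mult)
      also have "\<dots> \<le> \<eta> * (2 * R)" using \<eta> Re[OF k(1)] by (intro mult_left_mono) auto
      also have "\<dots> < \<epsilon>" using that R(1) \<open>\<epsilon> > 0\<close> by (simp add: \<eta>_def)
      finally show ?thesis using x \<phi>x by simp
    qed
    have cont\<phi>: "continuous_on ?P \<phi>"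
    proof -
      have "continuous_on ?P (\<lambda>p. A (p - R *\<^sub>R e))"
        unfolding A_def by (intro continuous_intros)
      then have "continuous_on ?P \<psi>"
        unfolding \<psi>_def
        by (rule continuous_on_compose2[OF continuous_on_closest_point[OF AK(2) AK_closed AK(3)]]) auto
      then show ?thesis unfolding \<phi>_def by (rule continuous_on_compose2[OF contB]) auto
    qed
    have "continuous_on ?P (\<lambda>p. \<pi> (\<alpha> (\<phi> p)))"
    proof (rule continuous_on_compose2[OF cont\<pi>])
      show "continuous_on ?P (\<lambda>p. \<alpha> (\<phi> p))"
        by (rule continuous_on_compose2[OF \<alpha>(1) cont\<phi>]) (use \<phi> in auto)
    qed auto
    moreover have "(\<lambda>p. \<pi> (\<alpha> (\<phi> p))) \<in> ?P \<rightarrow> ?P"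
    proof
      fix p assume "p \<in> ?P"
      then have "\<alpha> (\<phi> p) \<in> frontier K" using \<phi> \<alpha>(2) by blast
      then show "\<pi> (\<alpha> (\<phi> p)) \<in> ?P" using fr by blast
    qed
    ultimately obtain p where "p \<in> ?P" "\<pi> (\<alpha> (\<phi> p)) = p" using brouwer[OF P] by blast
    then show ?thesis using \<phi>[of p] by (intro bexI[of _ "\<phi> p"]) (auto simp: norm_minus_commute)
  qed
  have "compact (frontier K)" using K(1) compact_frontier by blast
  moreover have "frontier K \<noteq> {}" using approx[of 1] by auto
  moreover have "continuous_on (frontier K) (\<lambda>x. norm (\<pi> (\<alpha> x) - \<pi> x))"
    by (intro continuous_intros cont\<pi> continuous_on_compose2[OF cont\<pi> \<alpha>(1)]) auto
  ultimately obtain x where x: "x \<in> frontier K"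
    "\<And>y. y \<in> frontier K \<Longrightarrow> norm (\<pi> (\<alpha> x) - \<pi> x) \<le> norm (\<pi> (\<alpha> y) - \<pi> y)"
    using continuous_attains_inf[of "frontier K" "\<lambda>x. norm (\<pi> (\<alpha> x) - \<pi> x)"] by blast
  have "norm (\<pi> (\<alpha> x) - \<pi> x) \<le> 0"
  proof (rule ccontr)
    assume "\<not> ?thesis"
    then obtain y where "y \<in> frontier K" "norm (\<pi> (\<alpha> y) - \<pi> y) < norm (\<pi> (\<alpha> x) - \<pi> x)"
      using approx[of "norm (\<pi> (\<alpha> x) - \<pi> x)"] by auto
    then show False using x(2) by fastforce
  qed
  then have "\<alpha> x = x + ((\<alpha> x - x) \<bullet> e) *\<^sub>R e"
    by (simp add: \<pi>_def inner_diff_left algebra_simps)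
  then show ?thesis using that x(1) by blast
qed

section \<open>Bodies of large width contain large balls\<close>

text \<open>The point \<open>z\<close> is a centre in the sense of Minkowski and Radon: every chord through \<open>z\<close> is
  divided by it in a ratio no worse than \<open>1 : N - 1\<close>. The sets of candidates for the individual
  \<open>x \<in> K\<close> are compact and convex, and any \<open>N\<close> of them contain the centroid of their \<open>N\<close> points
  \<open>x\<close>, so Helly's theorem applies.\<close>
lemma Helly_centre:
  fixes K :: "'a::euclidean_space set"
  assumes K: "compact K" "convex K" "K \<noteq> {}"
  defines "N \<equiv> real (DIM('a) + 1)"
  obtains z where "\<And>x. x \<in> K \<Longrightarrow> \<exists>k\<in>K. z = (1 / N) *\<^sub>R x + (1 - 1 / N) *\<^sub>R k"
proof -
  define F where "F x = (\<lambda>k. (1 / N) *\<^sub>R x + (1 - 1 / N) *\<^sub>R k) ` K" for x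
  have N: "N > 1" using DIM_positive[where 'a='a] by (simp add: N_def)
  have few: "\<Inter>T \<noteq> {}" if T: "T \<subseteq> F ` K" "finite T" "card T \<le> DIM('a) + 1" for T
  proof (cases "T = {}")
    case True
    then show ?thesis by simp
  next
    case False
    obtain X where X: "X \<subseteq> K" "inj_on F X" "T = F ` X"
      using T(1) unfolding subset_image_inj by blast
    have fX: "finite X" and cX: "card X = card T" and neX: "X \<noteq> {}"
      using X T False by (auto simp: card_image dest: finite_imageD)
    let ?I = "{..<DIM('a) + 1}"
    obtain h where h: "bij_betw h {0..<card X} X"
      using ex_bij_betw_nat_finite[OF fX] by blast
    \<comment> \<open>Fewer than \<open>N\<close> points are listed with repetitions, to have a centroid of exactly \<open>N\<close> points.\<close>
    define x where "x i = h (if i < card X then i else 0)" for i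
    have cpos: "card X > 0" using fX neX by (simp add: card_gt_0_iff)
    have xX: "x i \<in> X" for i using h cpos by (auto simp: x_def bij_betw_def)
    have surj: "\<exists>i\<in>?I. x i = y" if y: "y \<in> X" for y
    proof -
      obtain i where "i < card X" "h i = y" using h y by (force simp: bij_betw_def)
      then show ?thesis using cX T(3) by (intro bexI[of _ i]) (auto simp: x_def)
    qed
    have "(\<Sum>i\<in>?I. (1 / N) *\<^sub>R x i) \<in> F y" if y: "y \<in> X" for y
    proof -
      obtain j where j: "j \<in> ?I" "x j = y" using surj[OF y] by blast
      \<comment> \<open>The centroid of \<open>N\<close> points divides the segment from \<open>x j\<close> to the centroid of the others.\<close>
      let ?k = "\<Sum>i\<in>?I - {j}. (1 / (N - 1)) *\<^sub>R x i"
      have "?k \<in> K"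
      proof (rule convex_sum[OF _ K(2)])
        show "(\<Sum>i\<in>?I - {j}. 1 / (N - 1)) = 1" using j(1) N by (simp add: N_def)
      qed (use N xX X(1) in auto)
      moreover have "(1 - 1 / N) *\<^sub>R ?k = (\<Sum>i\<in>?I - {j}. (1 / N) *\<^sub>R x i)"
        using N by (simp add: scaleR_right.sum field_simps)
      moreover have "(\<Sum>i\<in>?I. (1 / N) *\<^sub>R x i) = (1 / N) *\<^sub>R x j + (\<Sum>i\<in>?I - {j}. (1 / N) *\<^sub>R x i)"
        using j(1) by (intro sum.remove) auto
      ultimately show ?thesis unfolding F_def using j(2) by (intro image_eqI[of _ _ ?k]) simp_all
    qed
    then show ?thesis using X(3) by blast
  qed
  have "\<Inter>(F ` K) \<noteq> {}"
  proof (rule compact_fip_Heine_Borel)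
    fix T assume "T \<in> F ` K"
    then show "compact T" unfolding F_def
      by (auto intro!: compact_continuous_image continuous_intros K)
  next
    fix T assume T: "finite T" "T \<subseteq> F ` K"
    show "\<Inter>T \<noteq> {}"
    proof (cases "card T \<le> DIM('a) + 1")
      case True
      then show ?thesis using few T by blast
    next
      case False
      show ?thesis
      proof (rule Helly)
        show "\<forall>S\<in>T. convex S"
        proof
          fix S assume "S \<in> T"
          then obtain x where "S = F x" using T by blast
          moreover have "convex ((\<lambda>k. (1 / N) *\<^sub>R x + k) ` (*\<^sub>R) (1 - 1 / N) ` K)"
            by (intro convex_translation convex_scaling K)
          ultimately show "convex S" by (simp add: F_def image_image)
        qed
        show "\<Inter>t \<noteq> {}" if "t \<subseteq> T" "card t = DIM('a) + 1" for t
          using that T few[of t] finite_subset[of t T] by auto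
      qed (use False in simp)
    qed
  qed
  then obtain z where "\<forall>x\<in>K. z \<in> F x" by blast
  then show ?thesis using that unfolding F_def by blast
qed

text \<open>If a supporting hyperplane came closer to the centre than \<open>w / N\<close>, then, as the centre lies
  at least the fraction \<open>1 / N\<close> of the way across \<open>K\<close>, the width orthogonal to this hyperplane
  would be less than \<open>w\<close>.\<close>
lemma ball_in_thick_body:
  fixes K :: "'a::euclidean_space set"
  assumes K: "compact K" "convex K" "K \<noteq> {}"
    and wide: "\<And>u. norm u = 1 \<Longrightarrow> \<exists>k\<in>K. \<exists>l\<in>K. w \<le> (k - l) \<bullet> u"
  obtains z where "ball z (w / real (DIM('a) + 1)) \<subseteq> K"
proof -
  define N where "N = real (DIM('a) + 1)"
  have N: "N > 1" using DIM_positive[where 'a='a] by (simp add: N_def)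
  obtain z where z: "\<And>x. x \<in> K \<Longrightarrow> \<exists>k\<in>K. z = (1 / N) *\<^sub>R x + (1 - 1 / N) *\<^sub>R k"
    using Helly_centre[OF K] unfolding N_def by blast
  have "q \<in> K" if q: "q \<in> ball z (w / N)" for q
  proof (rule ccontr)
    assume "q \<notin> K"
    then obtain a b where ab: "a \<bullet> q < b" "\<And>x. x \<in> K \<Longrightarrow> a \<bullet> x > b"
      using separating_hyperplane_closed_point[of K q] K compact_imp_closed by blast
    have a: "a \<noteq> 0" using ab K(3) by fastforce
    define u where "u = a /\<^sub>R norm a"
    have u: "norm u = 1" using a by (simp add: u_def)
    have sep: "q \<bullet> u < x \<bullet> u" if "x \<in> K" for x
      using ab(1) ab(2)[OF that] a by (simp add: u_def inner_commute divide_simps)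
    obtain k1 k2 where k12: "k1 \<in> K" "k2 \<in> K" "w \<le> (k1 - k2) \<bullet> u" using wide[OF u] by blast
    \<comment> \<open>The centre is a proper average of the point \<open>k1\<close> far from the separating hyperplane and of some
        point of \<open>K\<close>, which is on the same side of it.\<close>
    obtain k where k: "k \<in> K" "z = (1 / N) *\<^sub>R k1 + (1 - 1 / N) *\<^sub>R k" using z[OF k12(1)] by blast
    have "w / N \<le> (1 / N) * (k1 \<bullet> u - k2 \<bullet> u)"
      using k12(3) N by (simp add: inner_diff_left divide_simps)
    also have "\<dots> \<le> (1 / N) * (k1 \<bullet> u - q \<bullet> u)"
      using sep[OF k12(2)] N by (intro mult_left_mono) auto
    also have "\<dots> \<le> (1 / N) * (k1 \<bullet> u - q \<bullet> u) + (1 - 1 / N) * (k \<bullet> u - q \<bullet> u)"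
      using sep[OF k(1)] N by simp
    also have "\<dots> = (z - q) \<bullet> u"
      unfolding k(2) by (simp add: inner_diff_left inner_add_left algebra_simps)
    also have "\<dots> \<le> norm (z - q)" using norm_cauchy_schwarz[of "z - q" u] u by simp
    finally show False using q by (simp add: dist_norm)
  qed
  then show ?thesis using that unfolding N_def by blast
qed

section \<open>Area and shadows\<close>

text \<open>The part within height \<open>\<rho>\<close> of \<open>c\<close> of the cylinder over a set of diameter \<open>D\<close> is covered by
  at most \<open>2 \<rho> / D + 1 \<le> 3 \<rho> / D\<close> balls of radius \<open>2D\<close> whose centres are stacked at distances
  \<open>D\<close> along \<open>e\<close>. The total volume is of order \<open>\<rho> D ^ n\<close>. The set \<open>B\<close> is introduced because the
  cylinder itself may fail to be measurable.\<close>
lemma vertical_cylinder_cover: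
  fixes U :: "'a::euclidean_space set"
  assumes e: "norm e = 1" and u0: "u0 \<in> U" "U \<subseteq> cball u0 D" and D: "0 < D" "D \<le> \<rho>"
  obtains B where "B \<in> sets borel"
    "\<And>u s. u \<in> U \<Longrightarrow> \<bar>(u + s *\<^sub>R e - c) \<bullet> e\<bar> \<le> \<rho> \<Longrightarrow> u + s *\<^sub>R e \<in> B"
    "emeasure lborel B
      \<le> ennreal (3 * \<rho> / D * (unit_ball_vol (real DIM('a)) * (2 * D) ^ DIM('a)))"
proof -
  have ee: "e \<bullet> e = 1" using e by (simp add: dot_square_norm)
  \<comment> \<open>\<open>c0\<close> is the bottom of the stack: on the axis through \<open>u0\<close>, at height \<open>\<rho>\<close> below \<open>c\<close>.\<close>
  define c0 where "c0 = u0 + ((c - u0) \<bullet> e - \<rho>) *\<^sub>R e"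
  define m where "m = nat \<lfloor>2 * \<rho> / D\<rfloor>"
  define B where "B = (\<Union>j\<in>{..m}. cball (c0 + (real j * D) *\<^sub>R e) (2 * D))"
  have \<rho>: "\<rho> > 0" using D by simp
  have "B \<in> sets borel" unfolding B_def by auto
  moreover have "u + s *\<^sub>R e \<in> B" if u: "u \<in> U" and h: "\<bar>(u + s *\<^sub>R e - c) \<bullet> e\<bar> \<le> \<rho>" for u s
  proof -
    define \<tau> where "\<tau> = (u + s *\<^sub>R e - c) \<bullet> e + \<rho>"
    have \<tau>: "0 \<le> \<tau>" "\<tau> \<le> 2 * \<rho>" using h by (auto simp: \<tau>_def)
    define j where "j = nat \<lfloor>\<tau> / D\<rfloor>"
    have "j \<le> m" unfolding j_def m_def using \<tau> D by (intro nat_mono floor_mono divide_right_mono) auto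
    have "real j = of_int \<lfloor>\<tau> / D\<rfloor>" unfolding j_def using \<tau> D by simp
    then have "real j \<le> \<tau> / D" "\<tau> / D < real j + 1" by linarith+
    then have j: "\<bar>\<tau> - real j * D\<bar> \<le> D" using D by (simp add: field_simps abs_le_iff)
    let ?p = "u - u0"
    have "u + s *\<^sub>R e - c0 - \<tau> *\<^sub>R e = ?p - (?p \<bullet> e) *\<^sub>R e"
      unfolding c0_def \<tau>_def using ee
      by (simp add: inner_diff_left inner_add_left algebra_simps)
    moreover have "norm (?p - (?p \<bullet> e) *\<^sub>R e) \<le> norm ?p"
      by (rule norm_orthogonal_part_le[OF e])
    moreover have "norm ?p \<le> D" using u0 u by (auto simp: dist_norm norm_minus_commute)
    ultimately have 1: "norm (u + s *\<^sub>R e - c0 - \<tau> *\<^sub>R e) \<le> D"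
      by (metis order_trans)
    have "norm ((\<tau> - real j * D) *\<^sub>R e) \<le> D" using j e by simp
    then have "norm (u + s *\<^sub>R e - c0 - \<tau> *\<^sub>R e + (\<tau> - real j * D) *\<^sub>R e) \<le> 2 * D"
      using 1 norm_triangle_ineq[of "u + s *\<^sub>R e - c0 - \<tau> *\<^sub>R e" "(\<tau> - real j * D) *\<^sub>R e"] by linarith
    moreover have "u + s *\<^sub>R e - c0 - \<tau> *\<^sub>R e + (\<tau> - real j * D) *\<^sub>R e
        = u + s *\<^sub>R e - (c0 + (real j * D) *\<^sub>R e)"
      by (simp add: algebra_simps)
    ultimately have "u + s *\<^sub>R e \<in> cball (c0 + (real j * D) *\<^sub>R e) (2 * D)"
      by (simp add: dist_norm norm_minus_commute)
    then show ?thesis unfolding B_def using \<open>j \<le> m\<close> by blast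
  qed
  moreover have "emeasure lborel B
      \<le> ennreal (3 * \<rho> / D * (unit_ball_vol (real DIM('a)) * (2 * D) ^ DIM('a)))"
  proof -
    let ?V = "unit_ball_vol (real DIM('a)) * (2 * D) ^ DIM('a)"
    have V: "?V \<ge> 0" using D by simp
    have "emeasure lborel B \<le> (\<Sum>j\<in>{..m}. emeasure lborel (cball (c0 + (real j * D) *\<^sub>R e) (2 * D)))"
      unfolding B_def by (intro emeasure_subadditive_finite) auto
    also have "\<dots> = (\<Sum>j\<in>{..m}. ennreal ?V)"
      using D by (intro sum.cong refl emeasure_cball) auto
    also have "\<dots> = ennreal ((real m + 1) * ?V)"
      using V by (subst sum_ennreal) (auto simp: algebra_simps)
    also have "\<dots> \<le> ennreal (3 * \<rho> / D * ?V)"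
    proof (intro ennreal_leI mult_right_mono V)
      have "real m \<le> 2 * \<rho> / D" unfolding m_def using D \<rho> by (simp add: of_nat_nat)
      moreover have "1 \<le> \<rho> / D" using D by simp
      ultimately show "real m + 1 \<le> 3 * \<rho> / D" by (simp add: add_divide_distrib)
    qed
    finally show ?thesis .
  qed
  ultimately show ?thesis using that by blast
qed

text \<open>This is the cylinder over a set of diameter \<open>0\<close>, for which there is no stack of balls.\<close>
lemma vertical_line_null:
  fixes u :: "'a::euclidean_space"
  assumes "DIM('a) \<ge> 2"
  obtains B where "B \<in> sets borel" "\<And>s. u + s *\<^sub>R e \<in> B" "emeasure lborel B = 0"
proof -
  obtain f :: 'a where f: "f \<noteq> 0" "orthogonal e f"
    using orthogonal_to_vector_exists[OF assms] by blast
  let ?B = "{x. f \<bullet> x = f \<bullet> u}"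
  have B: "?B \<in> sets borel" using closed_hyperplane by (intro borel_closed) auto
  have "negligible ?B" using f(1) by (simp add: negligible_hyperplane)
  then have "?B \<in> null_sets lborel"
    using B by (simp add: negligible_iff_null_sets null_sets_completion_iff)
  then have "emeasure lborel ?B = 0" by (rule null_setsD1)
  moreover have "u + s *\<^sub>R e \<in> ?B" for s
    using f(2) by (simp add: orthogonal_def inner_add_right inner_commute)
  ultimately show ?thesis using that[of ?B] B by blast
qed

text \<open>Fix a cover of \<open>M\<close> by sets of diameter at most \<open>\<rho>\<close>. The cylinders over its members cover
  \<open>ball c \<rho>\<close>, because each line of direction \<open>e\<close> through this ball meets \<open>M\<close>. Comparing volumes
  in dimension \<open>n + 1\<close> and dividing by \<open>\<rho>\<close> gives the bound. Covers by sets of diameter at most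
  \<open>\<rho>\<close> suffice, since the Hausdorff measure is a supremum over all such scales.\<close>
lemma hausdorff_measure_ge_shadow:
  fixes M :: "'a::euclidean_space set"
  assumes n: "n \<ge> 1" "DIM('a) = n + 1" and e: "norm e = 1" and \<rho>: "\<rho> > 0"
    and shadow: "\<And>v. v \<bullet> e = 0 \<Longrightarrow> norm v < \<rho> \<Longrightarrow> \<exists>s. c + v + s *\<^sub>R e \<in> M"
  shows "ennreal (unit_ball_vol (real n) * \<rho> ^ n / (3 * 2 ^ (2 * n + 1))) \<le> hausdorff_measure n M"
proof -
  have ee: "e \<bullet> e = 1" using e by (simp add: dot_square_norm)
  let ?W = "unit_ball_vol (real DIM('a))" and ?\<omega> = "unit_ball_vol (real n)"
  have W: "?W \<noteq> 0" "?\<omega> \<noteq> 0"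
    using unit_ball_vol_pos[of "real DIM('a)"] unit_ball_vol_pos[of "real n"] by linarith+
  \<comment> \<open>\<open>\<kappa>\<close> is the ratio of the volume bound for a cylinder to the Hausdorff weight of its base.\<close>
  define \<kappa> where "\<kappa> = 3 * \<rho> * 2 ^ (2 * n + 1) * ?W / ?\<omega>"
  have \<kappa>: "\<kappa> > 0" using \<rho> by (simp add: \<kappa>_def)
  have "ennreal (?\<omega> * \<rho> ^ n / (3 * 2 ^ (2 * n + 1))) \<le> hausdorff_premeasure n \<rho> M"
    unfolding hausdorff_premeasure_def
  proof (rule INF_greatest)
    fix U :: "nat \<Rightarrow> 'a set"
    assume "U \<in> {U. M \<subseteq> (\<Union>i. U i) \<and> (\<forall>i. bounded (U i) \<and> diameter (U i) \<le> \<rho>)}"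
    then have U: "M \<subseteq> (\<Union>i. U i)" "\<And>i. bounded (U i)" "\<And>i. diameter (U i) \<le> \<rho>" by auto
    have "\<exists>B. B \<in> sets borel \<and>
        (\<forall>u s. u \<in> U i \<longrightarrow> \<bar>(u + s *\<^sub>R e - c) \<bullet> e\<bar> \<le> \<rho> \<longrightarrow> u + s *\<^sub>R e \<in> B) \<and>
        emeasure lborel B \<le> ennreal \<kappa> * hausdorff_weight n (U i)" for i
    proof (cases "U i = {}")
      case True
      then show ?thesis by (intro exI[of _ "{}"]) auto
    next
      case False
      then obtain u0 where u0: "u0 \<in> U i" by blast
      let ?D = "diameter (U i)"
      have sub: "U i \<subseteq> cball u0 ?D"
        using diameter_bounded_bound[OF U(2) u0] by auto
      show ?thesis
      proof (cases "?D = 0")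
        case True
        obtain B where "B \<in> sets borel" "\<And>s. u0 + s *\<^sub>R e \<in> B" "emeasure lborel B = 0"
          using vertical_line_null[of u0 e] n by auto
        then show ?thesis using sub True by (intro exI[of _ B]) auto
      next
        case False
        then have D: "?D > 0" using diameter_ge_0[OF U(2)] by (simp add: order_less_le)
        obtain B where B: "B \<in> sets borel"
          "\<And>u s. u \<in> U i \<Longrightarrow> \<bar>(u + s *\<^sub>R e - c) \<bullet> e\<bar> \<le> \<rho> \<Longrightarrow> u + s *\<^sub>R e \<in> B"
          "emeasure lborel B \<le> ennreal (3 * \<rho> / ?D * (?W * (2 * ?D) ^ DIM('a)))"
          using vertical_cylinder_cover[OF e u0 sub D U(3)] by blast
        have "3 * \<rho> / ?D * (?W * (2 * ?D) ^ DIM('a)) = \<kappa> * (?\<omega> * (?D / 2) ^ n)"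
        proof -
          have "3 * \<rho> / ?D * (?W * (2 * ?D) ^ DIM('a)) = 3 * \<rho> * ?W * 2 ^ (n + 1) * ?D ^ n"
            using D unfolding n(2) power_mult_distrib by simp
          also have "\<dots> = 3 * \<rho> * (2 ^ n * 2 ^ (n + 1)) * ?W * (?D / 2) ^ n"
            by (simp add: power_divide)
          also have "(2::real) ^ n * 2 ^ (n + 1) = 2 ^ (2 * n + 1)"
            unfolding mult_2[of n] power_add by simp
          also have "3 * \<rho> * 2 ^ (2 * n + 1) * ?W * (?D / 2) ^ n = \<kappa> * (?\<omega> * (?D / 2) ^ n)"
            using W(2) by (simp add: \<kappa>_def)
          finally show ?thesis .
        qed
        then have "emeasure lborel B \<le> ennreal \<kappa> * hausdorff_weight n (U i)"
          using B(3) \<open>U i \<noteq> {}\<close> \<kappa> by (simp only: hausdorff_weight_def if_False ennreal_mult')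
        then show ?thesis using B by blast
      qed
    qed
    then obtain B where B: "\<And>i. B i \<in> sets borel"
      "\<And>i u s. u \<in> U i \<Longrightarrow> \<bar>(u + s *\<^sub>R e - c) \<bullet> e\<bar> \<le> \<rho> \<Longrightarrow> u + s *\<^sub>R e \<in> B i"
      "\<And>i. emeasure lborel (B i) \<le> ennreal \<kappa> * hausdorff_weight n (U i)"
      by metis
    have "ball c \<rho> \<subseteq> (\<Union>i. B i)"
    proof
      fix z assume "z \<in> ball c \<rho>"
      then have z: "norm (z - c) < \<rho>" by (simp add: dist_norm norm_minus_commute)
      let ?t = "(z - c) \<bullet> e"
      define v where "v = z - c - ?t *\<^sub>R e"
      have "v \<bullet> e = 0" using ee by (simp add: v_def inner_diff_left)
      moreover have "norm v \<le> norm (z - c)"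
        unfolding v_def by (rule norm_orthogonal_part_le[OF e])
      ultimately obtain s where "c + v + s *\<^sub>R e \<in> M" using shadow z by fastforce
      then obtain i where i: "c + v + s *\<^sub>R e \<in> U i" using U(1) by blast
      have eq: "c + v + s *\<^sub>R e + (?t - s) *\<^sub>R e = z"
        by (simp add: v_def algebra_simps)
      have "\<bar>?t\<bar> \<le> \<rho>" using Cauchy_Schwarz_ineq2[of "z - c" e] e z by simp
      then have "z \<in> B i" using B(2)[OF i, of "?t - s"] unfolding eq by blast
      then show "z \<in> (\<Union>i. B i)" by blast
    qed
    then have "emeasure lborel (ball c \<rho>) \<le> emeasure lborel (\<Union>i. B i)"
      using B(1) by (intro emeasure_mono) auto
    also have "\<dots> \<le> (\<Sum>i. emeasure lborel (B i))"
      using B(1) by (intro emeasure_subadditive_countably) auto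
    also have "\<dots> \<le> (\<Sum>i. ennreal \<kappa> * hausdorff_weight n (U i))"
      by (intro suminf_le B(3)) auto
    also have "\<dots> = ennreal \<kappa> * (\<Sum>i. hausdorff_weight n (U i))" by (rule ennreal_suminf_cmult)
    finally have "ennreal (?W * \<rho> ^ DIM('a)) \<le> ennreal \<kappa> * (\<Sum>i. hausdorff_weight n (U i))"
      using \<rho> by (simp add: emeasure_ball)
    moreover have "?W * \<rho> ^ DIM('a) = \<kappa> * (?\<omega> * \<rho> ^ n / (3 * 2 ^ (2 * n + 1)))"
      using W \<rho> n(2) by (simp add: \<kappa>_def)
    ultimately have "ennreal \<kappa> * ennreal (?\<omega> * \<rho> ^ n / (3 * 2 ^ (2 * n + 1)))
        \<le> ennreal \<kappa> * (\<Sum>i. hausdorff_weight n (U i))"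
      by (simp only: ennreal_mult'[OF less_imp_le[OF \<kappa>]])
    then show "ennreal (?\<omega> * \<rho> ^ n / (3 * 2 ^ (2 * n + 1))) \<le> (\<Sum>i. hausdorff_weight n (U i))"
      using \<kappa> by (simp add: ennreal_mult_le_mult_iff)
  qed
  also have "\<dots> \<le> hausdorff_measure n M"
    unfolding hausdorff_measure_def using \<rho> by (intro SUP_upper) auto
  finally show ?thesis .
qed

section \<open>Displacement, shadows and the inequality\<close>

lemma vertical_line_meets_frontier:
  fixes K :: "'a::real_normed_vector set"
  assumes "bounded K" "p \<in> K" "e \<noteq> 0"
  obtains s where "p + s *\<^sub>R e \<in> frontier K"
proof -
  let ?L = "range (\<lambda>s::real. p + s *\<^sub>R e)"
  obtain R where R: "R > 0" "\<And>z. z \<in> K \<Longrightarrow> norm z \<le> R"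
    using assms(1) unfolding bounded_pos by blast
  have "connected ?L" by (intro connected_continuous_image continuous_intros) auto
  moreover have "p + 0 *\<^sub>R e \<in> ?L \<inter> K" using assms(2) by auto
  then have "?L \<inter> K \<noteq> {}" by blast
  moreover have "?L - K \<noteq> {}"
  proof -
    let ?s = "(2 * R + 1) / norm e"
    have "norm (?s *\<^sub>R e) = 2 * R + 1" using assms(3) R(1) by simp
    moreover have "norm (?s *\<^sub>R e) \<le> norm (p + ?s *\<^sub>R e) + norm p"
      using norm_triangle_ineq4[of "p + ?s *\<^sub>R e" p] by simp
    ultimately have "p + ?s *\<^sub>R e \<notin> K" using R(2)[OF assms(2)] R(2)[of "p + ?s *\<^sub>R e"] by linarith
    then show ?thesis by blast
  qed
  ultimately have "?L \<inter> frontier K \<noteq> {}" by (rule connected_Int_frontier)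
  then show ?thesis using that by blast
qed

text \<open>The shadow is the orthogonal projection along \<open>e\<close>. It is expressed by lines of direction \<open>e\<close>
  in the ambient space, so that no Euclidean space of smaller dimension is involved.\<close>
definition shadow_has_disc :: "'a::real_inner set \<Rightarrow> 'a \<Rightarrow> real \<Rightarrow> bool" where
  "shadow_has_disc M e \<rho> \<longleftrightarrow>
    (\<exists>c. \<forall>v. v \<bullet> e = 0 \<longrightarrow> norm v < \<rho> \<longrightarrow> (\<exists>s. c + v + s *\<^sub>R e \<in> M))"

lemma shadow_has_disc_frontier:
  assumes "bounded K" "e \<noteq> 0" and "shadow_has_disc K e \<rho>"
  shows "shadow_has_disc (frontier K) e \<rho>"
proof -
  obtain c where c: "\<And>v. v \<bullet> e = 0 \<Longrightarrow> norm v < \<rho> \<Longrightarrow> \<exists>s. c + v + s *\<^sub>R e \<in> K"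
    using assms(3) unfolding shadow_has_disc_def by blast
  have "\<exists>s. c + v + s *\<^sub>R e \<in> frontier K" if v: "v \<bullet> e = 0" "norm v < \<rho>" for v
  proof -
    obtain s where s: "c + v + s *\<^sub>R e \<in> K" using c v by blast
    obtain t where "c + v + s *\<^sub>R e + t *\<^sub>R e \<in> frontier K"
      using vertical_line_meets_frontier[OF assms(1) s assms(2)] .
    then show ?thesis
      by (intro exI[of _ "s + t"]) (simp add: scaleR_left_distrib add.assoc)
  qed
  then show ?thesis unfolding shadow_has_disc_def by blast
qed

lemma shadow_has_disc_ball:
  fixes K :: "'a::real_inner set"
  assumes "ball z \<rho> \<subseteq> K"
  shows "shadow_has_disc K e \<rho>"
  unfolding shadow_has_disc_def
proof (intro exI[of _ z] allI impI)
  fix v :: 'a assume "norm v < \<rho>"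
  then have "z + v \<in> ball z \<rho>" by (simp add: dist_norm)
  then have "z + v + 0 *\<^sub>R e \<in> K" using assms by auto
  then show "\<exists>s. z + v + s *\<^sub>R e \<in> K" by blast
qed

text \<open>The two cases are those of a body of large width, which contains a ball, and of a thin body,
  where \<open>x\<close> and \<open>\<alpha>(x)\<close> lie on one line of direction \<open>e\<close> and every short detour is blocked. A
  detour costs at most \<open>24 w\<close>, so \<open>w = r / 32\<close> makes it shorter than \<open>r\<close>.\<close>
lemma shadow_disc_of_displacement:
  fixes K :: "'a::euclidean_space set"
  assumes K: "compact K" "convex K" "interior K \<noteq> {}"
    and \<alpha>: "continuous_on (frontier K) \<alpha>" "\<alpha> \<in> frontier K \<rightarrow> frontier K"
    and r: "r > 0" "ennreal r \<le> min_displacement (frontier K) \<alpha>"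
  obtains e where "norm e = 1"
    "shadow_has_disc (frontier K) e (r / (32 * real (DIM('a) + 1)))"
proof -
  define w where "w = r / 32"
  have w: "w > 0" "24 * w < r" using r by (simp_all add: w_def)
  have bdd: "bounded K" using K(1) compact_imp_bounded by blast
  have neK: "K \<noteq> {}" using K(3) interior_subset by blast
  show ?thesis
  proof (cases "\<forall>u. norm u = 1 \<longrightarrow> (\<exists>k\<in>K. \<exists>l\<in>K. w \<le> (k - l) \<bullet> u)")
    case True
    then obtain z where z: "ball z (w / real (DIM('a) + 1)) \<subseteq> K"
      using ball_in_thick_body[OF K(1,2) neK, of w] by blast
    obtain e :: 'a where e: "norm e = 1" using vector_choose_size[of 1] by auto
    then have "e \<noteq> 0" by auto
    then have "shadow_has_disc (frontier K) e (w / real (DIM('a) + 1))"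
      by (rule shadow_has_disc_frontier[OF bdd _ shadow_has_disc_ball[OF z]])
    then show ?thesis using that[OF e] by (simp add: w_def)
  next
    case False
    then obtain e where e: "norm e = 1" and thin: "\<And>k l. k \<in> K \<Longrightarrow> l \<in> K \<Longrightarrow> (k - l) \<bullet> e < w"
      by (auto simp: not_le)
    obtain x b where x: "x \<in> frontier K" "\<alpha> x = x + b *\<^sub>R e"
      using fixed_fibre_exists[OF K \<alpha> e] .
    have y: "x + b *\<^sub>R e \<in> frontier K" using \<alpha>(2) x by (metis PiE)
    have far: "ennreal r \<le> intrinsic_dist (frontier K) x (x + b *\<^sub>R e)"
      using r(2) x unfolding min_displacement_def by (metis INF_lower order_trans)
    have near: False if "intrinsic_dist (frontier K) x (x + b *\<^sub>R e) \<le> ennreal (24 * w)"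
    proof -
      have "ennreal r \<le> ennreal (24 * w)" using far that by (rule order_trans)
      then show False using w by (simp add: ennreal_le_iff)
    qed
    have "\<exists>s. x + v + s *\<^sub>R e \<in> K" if v: "v \<bullet> e = 0" "norm v \<le> w" for v
    proof (rule ccontr)
      assume miss: "\<not> ?thesis"
      consider "b > 0" | "b < 0" | "b = 0" by linarith
      then show False
      proof cases
        case 1
        show False
          by (rule near, rule intrinsic_dist_le_detour[OF K e thin x(1) y 1 v]) (use miss in auto)
      next
        case 2
        \<comment> \<open>The point \<open>\<alpha> x\<close> is below \<open>x\<close>: turn the picture upside down.\<close>
        have "intrinsic_dist (frontier K) x (x + (- b) *\<^sub>R (- e)) \<le> ennreal (24 * w)"
        proof (rule intrinsic_dist_le_detour[OF K _ _ x(1)])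
          show "(k - l) \<bullet> - e < w" if "k \<in> K" "l \<in> K" for k l
            using thin[OF that(2,1)] by (simp add: inner_diff_left)
          show "x + v + s *\<^sub>R - e \<notin> K" for s
            using miss by (metis scaleR_minus_left scaleR_minus_right)
        qed (use e y 2 v in auto)
        then show False using near by simp
      next
        case 3
        have "lipschitz_joined (- interior K) (24 * w) x x"
          using x(1) w(1) by (intro lipschitz_joined_segment) (auto simp: frontier_def)
        then show False
          using near intrinsic_dist_le_outer_path[OF K x(1) x(1)] 3 by simp
      qed
    qed
    moreover have "r / (32 * real (DIM('a) + 1)) \<le> w"
      using r by (simp add: w_def field_simps)
    ultimately have "shadow_has_disc K e (r / (32 * real (DIM('a) + 1)))"
      unfolding shadow_has_disc_def by (intro exI[of _ x]) fastforce
    moreover have "e \<noteq> 0" using e by auto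
    ultimately show ?thesis using that[OF e] shadow_has_disc_frontier[OF bdd] by blast
  qed
qed

text \<open>The points of \<open>M\<close> over two opposite points of the disc are at least as far apart as these.\<close>
lemma shadow_disc_radius_bounded:
  fixes M :: "'a::euclidean_space set"
  assumes "DIM('a) \<ge> 2" "norm e = 1" "\<And>z. z \<in> M \<Longrightarrow> norm z \<le> R" "shadow_has_disc M e \<rho>" "\<rho> > 0"
  shows "\<rho> \<le> R"
proof (rule ccontr)
  assume "\<not> ?thesis"
  then have \<rho>: "R < \<rho>" by simp
  obtain c where c: "\<And>v. v \<bullet> e = 0 \<Longrightarrow> norm v < \<rho> \<Longrightarrow> \<exists>s. c + v + s *\<^sub>R e \<in> M"
    using assms(4) unfolding shadow_has_disc_def by blast
  obtain f :: 'a where f: "f \<noteq> 0" "orthogonal e f"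
    using orthogonal_to_vector_exists[OF assms(1)] by blast
  \<comment> \<open>\<open>t\<close> lies strictly between \<open>R\<close> and \<open>\<rho>\<close>; the maximum keeps it nonnegative when \<open>R\<close> is negative.\<close>
  define t where "t = max 0 ((R + \<rho>) / 2)"
  have t: "0 \<le> t" "t < \<rho>" "R < t" using \<rho> assms(5) unfolding t_def by (auto simp: max_def)
  define v where "v = (t / norm f) *\<^sub>R f"
  have nv: "norm v = t" using f t by (simp add: v_def)
  have ve: "v \<bullet> e = 0" using f(2) by (simp add: v_def orthogonal_def inner_commute)
  obtain s where s: "c + v + s *\<^sub>R e \<in> M" using c[of v] nv ve t by auto
  obtain s' where s': "c + (- v) + s' *\<^sub>R e \<in> M" using c[of "- v"] nv ve t by auto
  let ?d = "(c + v + s *\<^sub>R e) - (c + (- v) + s' *\<^sub>R e)"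
  have d: "?d = 2 *\<^sub>R v + (s - s') *\<^sub>R e" by (simp add: algebra_simps scaleR_2)
  have "e \<bullet> e = 1" using assms(2) by (simp add: dot_square_norm)
  then have "?d \<bullet> e = s - s'" using ve unfolding d by (simp add: inner_add_left)
  then have "norm (2 *\<^sub>R v) \<le> norm ?d"
    using norm_orthogonal_part_le[OF assms(2), of ?d] d by simp
  also have "\<dots> \<le> R + R"
    using norm_triangle_ineq4[of "c + v + s *\<^sub>R e" "c + (- v) + s' *\<^sub>R e"]
      assms(3)[OF s] assms(3)[OF s'] by linarith
  finally show False using nv t by simp
qed

theorem theorem1p1:
  fixes n :: nat
  assumes "n \<ge> 1" and "CARD('d::finite) = n + 1"
  shows "\<exists>h::real. h > 0 \<and>
    (\<forall>(M :: (real ^ 'd) set) \<alpha>.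
       closed_convex_hypersurface M \<longrightarrow> continuous_on M \<alpha> \<longrightarrow> \<alpha> \<in> M \<rightarrow> M \<longrightarrow>
       hausdorff_measure n M > ennreal h * min_displacement M \<alpha> ^ n)"
proof -
  define N where "N = real (DIM(real ^ 'd) + 1)"
  define a where "a = unit_ball_vol (real n) / (3 * 2 ^ (2 * n + 1))"
  \<comment> \<open>The factor \<open>32 N\<close> is the ratio of the displacement to the radius of the disc in the shadow;
      half of the constant so obtained makes the inequality strict.\<close>
  define h where "h = a / (32 * N) ^ n / 2"
  have N: "N > 0" by (simp add: N_def)
  have a: "a > 0" by (simp add: a_def)
  have h: "h > 0" using a N by (simp add: h_def)
  have dim: "DIM(real ^ 'd) = n + 1" using assms(2) by simp
  have area: "ennreal (a * \<rho> ^ n) \<le> hausdorff_measure n M"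
    if e\<rho>: "norm e = 1" "\<rho> > 0" and disc: "shadow_has_disc M e \<rho>" for M :: "(real ^ 'd) set" and e \<rho>
  proof -
    obtain c where "\<And>v. v \<bullet> e = 0 \<Longrightarrow> norm v < \<rho> \<Longrightarrow> \<exists>s. c + v + s *\<^sub>R e \<in> M"
      using disc unfolding shadow_has_disc_def by blast
    from hausdorff_measure_ge_shadow[OF assms(1) dim e\<rho> this]
    show ?thesis by (simp add: a_def)
  qed
  have "ennreal h * min_displacement M \<alpha> ^ n < hausdorff_measure n M"
    if M: "closed_convex_hypersurface M"
      and \<alpha>: "continuous_on M \<alpha>" "\<alpha> \<in> M \<rightarrow> M" for M :: "(real ^ 'd) set" and \<alpha>
  proof -
    obtain K where K: "compact K" "convex K" "interior K \<noteq> {}" and MK: "M = frontier K"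
      using M unfolding closed_convex_hypersurface_def by blast
    have bdd: "bounded K" using K(1) compact_imp_bounded by blast
    note \<alpha>' = \<alpha>[unfolded MK]
    have disc: "\<exists>e. norm e = 1 \<and> shadow_has_disc M e (r / (32 * N))"
      if "r > 0" "ennreal r \<le> min_displacement M \<alpha>" for r
      using shadow_disc_of_displacement[OF K \<alpha>', of r] that unfolding MK N_def by blast
    have pos: "hausdorff_measure n M > 0"
    proof -
      obtain z \<rho> where z: "\<rho> > 0" "ball z \<rho> \<subseteq> K"
        using K(3) unfolding mem_interior[symmetric] by (meson ex_in_conv mem_interior)
      obtain e :: "real ^ 'd" where e: "norm e = 1" using vector_choose_size[of 1] by auto
      then have "e \<noteq> 0" by auto
      then have "shadow_has_disc M e \<rho>"
        unfolding MK by (rule shadow_has_disc_frontier[OF bdd _ shadow_has_disc_ball[OF z(2)]])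
      then have "ennreal (a * \<rho> ^ n) \<le> hausdorff_measure n M" by (rule area[OF e z(1)])
      moreover have "0 < ennreal (a * \<rho> ^ n)" using a z(1) by simp
      ultimately show ?thesis by (rule less_le_trans[rotated])
    qed
    have fin: "min_displacement M \<alpha> \<noteq> top"
    proof
      assume inf: "min_displacement M \<alpha> = top"
      obtain R where R: "R > 0" "\<And>z. z \<in> M \<Longrightarrow> norm z \<le> R"
        using compact_imp_bounded[OF compact_frontier[OF K(1)]] unfolding bounded_pos MK by blast
      obtain e where "norm e = 1" "shadow_has_disc M e (32 * N * (2 * R) / (32 * N))"
        using disc[of "32 * N * (2 * R)"] inf N R(1) by auto
      then have "32 * N * (2 * R) / (32 * N) \<le> R"
        using shadow_disc_radius_bounded[of e M R] R(1,2) dim assms(1) N by auto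
      then show False using N R(1) by simp
    qed
    show ?thesis
    proof (cases "min_displacement M \<alpha> = 0")
      case True
      then show ?thesis using pos assms(1) by (simp add: power_0_left)
    next
      case False
      obtain r where r: "r \<ge> 0" "min_displacement M \<alpha> = ennreal r"
        using fin by (cases "min_displacement M \<alpha>") auto
      then have rpos: "r > 0" using False by (auto simp: order_less_le)
      obtain e where e: "norm e = 1" "shadow_has_disc M e (r / (32 * N))"
        using disc[OF rpos] r(2) by auto
      have "ennreal h * min_displacement M \<alpha> ^ n = ennreal (h * r ^ n)"
        using r h by (simp add: ennreal_mult' ennreal_power)
      also have "\<dots> < ennreal (2 * (h * r ^ n))"
        using h rpos by (intro ennreal_lessI) auto
      also have "2 * (h * r ^ n) = a * (r / (32 * N)) ^ n"
        by (simp add: h_def power_divide)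
      also have "ennreal \<dots> \<le> hausdorff_measure n M"
        using area[OF e(1) _ e(2)] rpos N by simp
      finally show ?thesis .
    qed
  qed
  then show ?thesis using h by (intro exI[of _ h]) auto
qed

end
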